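(* Let $\Gamma_1,\dots,\Gamma_t$ be finite simple non-complete graphs such that $\mathrm{Dom}(\Gamma_i)\ne\emptyset$ for all $i=1,\dots,t$. Then $$\gamma\Bigl(\Gamma_1\otimes\cdots\otimes\Gamma_t\setminus\bigl(\mathrm{Dom}(\Gamma_1)\times\cdots\times\mathrm{Dom}(\Gamma_t)\bigr)\Bigr)=\min_{1\le i\le t}\gamma\bigl(\Gamma_i\setminus\mathrm{Dom}(\Gamma_i)\bigr).$$
   Context: For a finite simple graph $\Gamma$ with vertex set $V$, $\mathrm{Dom}(\Gamma)$ is the set of vertices adjacent to every other vertex of $\Gamma$. For $S\subseteq V$, $\Gamma\setminus S$ denotes the induced subgraph on $V\setminus S$. A dominating set of $\Gamma$ is a subset $X\subseteq V$ such that every vertex of $V\setminus X$ is adjacent to some vertex of $X$; the domination number $\gamma(\Gamma)$ is the minimum cardinality of a dominating set. The strong product $\Gamma_1\otimes\cdots\otimes\Gamma_t$ has vertex set $V(\Gamma_1)\times\cdots\times V(\Gamma_t)$, and two distinct tuples are adjacent if and only if in every coordinate $i$ their entries are equal or adjacent in $\Gamma_i$. *)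

theory Defs
  imports "Graph_Theory.Graph_Theory" "HOL-Library.FuncSet"
begin

definition dominating_vertices :: "('a, 'b) pre_digraph \<Rightarrow> 'a set" where
  "dominating_vertices G = {v \<in> verts G. \<forall>u \<in> verts G. u \<noteq> v \<longrightarrow> v \<rightarrow>\<^bsub>G\<^esub> u}"

definition remove_verts :: "('a, 'b) pre_digraph \<Rightarrow> 'a set \<Rightarrow> ('a, 'b) pre_digraph" where
  "remove_verts G S = G \<restriction> (verts G - S)"

definition dominating_set :: "('a, 'b) pre_digraph \<Rightarrow> 'a set \<Rightarrow> bool" where
  "dominating_set G X \<longleftrightarrow> X \<subseteq> verts G \<and> (\<forall>v \<in> verts G - X. \<exists>x \<in> X. v \<rightarrow>\<^bsub>G\<^esub> x)"

definition domination_number :: "('a, 'b) pre_digraph \<Rightarrow> nat" where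
  "domination_number G = Min {card X | X. dominating_set G X}"

text \<open>
  The factors are indexed by \<open>I\<close>, and a tuple of vertices is an extensional function on \<open>I\<close>.
\<close>

definition strong_product ::
    "'i set \<Rightarrow> ('i \<Rightarrow> ('a, 'b) pre_digraph) \<Rightarrow> ('i \<Rightarrow> 'a) pair_pre_digraph" where
  "strong_product I G =
     \<lparr> pverts = (\<Pi>\<^sub>E i\<in>I. verts (G i)),
       parcs = {(x, y). x \<in> (\<Pi>\<^sub>E i\<in>I. verts (G i)) \<and> y \<in> (\<Pi>\<^sub>E i\<in>I. verts (G i)) \<and> x \<noteq> y \<and>
                        (\<forall>i\<in>I. x i = y i \<or> x i \<rightarrow>\<^bsub>G i\<^esub> y i)} \<rparr>"

lemma graph_remove_verts:
  assumes "graph G"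
  shows "graph (remove_verts G S)"
proof -
  interpret graph G by fact
  have "induced_subgraph (remove_verts G S) G"
    unfolding remove_verts_def by (rule induced_induce) auto
  then show ?thesis
    by (meson digraph.graphI digraphI_induced induced_graph_imp_symmetric sym_arcs)
qed

lemma pair_graph_strong_product:
  assumes "finite I" and "\<And>i. i \<in> I \<Longrightarrow> graph (G i)"
  shows "pair_graph (strong_product I G)"
proof -
  have fin: "finite (\<Pi>\<^sub>E i\<in>I. verts (G i))"
    using assms by (intro finite_PiE) (auto dest: graph.axioms digraph.axioms fin_digraph.finite_verts)
  have sym: "u \<rightarrow>\<^bsub>G i\<^esub> v \<Longrightarrow> v \<rightarrow>\<^bsub>G i\<^esub> u" if "i \<in> I" for i u v
    using assms(2)[OF that] sym_digraph.sym_arcs[of "G i"]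
    by (auto simp: graph_def pseudo_graph_def symmetric_def dest: symD)
  show ?thesis
  proof
    show "finite (parcs (strong_product I G))"
      by (rule finite_subset[OF _ finite_cartesian_product[OF fin fin]])
        (auto simp: strong_product_def)
  next
    show "symmetric (strong_product I G)"
      unfolding symmetric_def
      by (rule symI) (simp add: strong_product_def, metis sym)
  qed (use fin in \<open>auto simp: strong_product_def\<close>)
qed

end

theory Submission
  imports Defs
begin

text \<open>
  Write \<open>D\<^sub>i\<close> for the set of dominating vertices of \<open>G\<^sub>i\<close>, and call two vertices close if they are
  equal or adjacent. Two tuples of the strong product are close if and only if all their
  coordinates are close.

  For the upper bound, take a factor \<open>G\<^sub>i\<close> and a dominating set \<open>Y\<close> of \<open>G\<^sub>i - D\<^sub>i\<close>, and extend each
  \<open>y \<in> Y\<close> to a tuple by putting a dominating vertex in every coordinate other than \<open>i\<close>. Those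
  coordinates are close to everything, so only coordinate \<open>i\<close> matters. There a vertex outside \<open>D\<^sub>i\<close>
  is close to some \<open>y \<in> Y\<close> by choice of \<open>Y\<close>, and a vertex in \<open>D\<^sub>i\<close> is close to all of \<open>Y\<close>; the set
  \<open>Y\<close> is nonempty because \<open>G\<^sub>i\<close> is not complete
  (\<open>domination_number_product_le_factor\<close>).

  For the lower bound, let \<open>X\<close> be a dominating set of the punctured product. The coordinates
  outside \<open>D\<^sub>i\<close> of its elements form a set \<open>X\<^sub>i\<close> of at most \<open>card X\<close> vertices of \<open>G\<^sub>i - D\<^sub>i\<close>. If no
  \<open>X\<^sub>i\<close> were dominating, one could choose in every factor a vertex \<open>v\<^sub>i \<notin> D\<^sub>i\<close> that is far from all
  of \<open>X\<^sub>i\<close>. The tuple \<open>v\<close> would be close to some \<open>x \<in> X\<close>; but \<open>x\<close> lies outside the product of the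
  \<open>D\<^sub>i\<close>, so some coordinate \<open>x\<^sub>i\<close> is in \<open>X\<^sub>i\<close>, a contradiction
  (\<open>some_factor_domination_number_le_product\<close>).
\<close>

lemma card_dominating_sets_finite:
  assumes "finite (verts G)"
  shows "finite {card X | X. dominating_set G X}"
proof -
  have "{card X | X. dominating_set G X} \<subseteq> card ` Pow (verts G)"
    by (auto simp: dominating_set_def)
  then show ?thesis
    using assms finite_surj by blast
qed

lemma domination_number_le:
  assumes "finite (verts G)" and "dominating_set G X"
  shows "domination_number G \<le> card X"
  unfolding domination_number_def
  using assms card_dominating_sets_finite by (intro Min_le) auto

lemma minimum_dominating_set_exists:
  assumes "finite (verts G)"
  obtains X where "dominating_set G X" and "card X = domination_number G"
proof -
  have "dominating_set G (verts G)"
    by (auto simp: dominating_set_def)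
  then have "{card X | X. dominating_set G X} \<noteq> {}"
    by blast
  from Min_in[OF card_dominating_sets_finite[OF assms] this] that show thesis
    by (auto simp: domination_number_def)
qed

lemma verts_remove_verts [simp]: "verts (remove_verts G S) = verts G - S"
  by (simp add: remove_verts_def)

text \<open>
  Closeness (equality or adjacency) is what the strong product handles coordinatewise, so
  domination is expressed by it: an element of \<open>X\<close> is then covered by itself, and no case
  distinction on membership in \<open>X\<close> remains.
\<close>

lemma dominating_set_remove_verts_iff:
  "dominating_set (remove_verts G S) X \<longleftrightarrow>
     X \<subseteq> verts G - S \<and> (\<forall>v \<in> verts G - S. \<exists>x \<in> X. v = x \<or> v \<rightarrow>\<^bsub>G\<^esub> x)"
proof -
  have "v \<rightarrow>\<^bsub>remove_verts G S\<^esub> x \<longleftrightarrow> v \<rightarrow>\<^bsub>G\<^esub> x"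
    if "v \<in> verts G - S" "x \<in> verts G - S" for v x
    using that by (auto simp: remove_verts_def arcs_ends_def arc_to_ends_def)
  then show ?thesis
    unfolding dominating_set_def verts_remove_verts by blast
qed

lemma pverts_strong_product [simp]:
  "pverts (strong_product I G) = (\<Pi>\<^sub>E i\<in>I. verts (G i))"
  by (simp add: strong_product_def)

lemma strong_product_close_iff:
  assumes "x \<in> (\<Pi>\<^sub>E i\<in>I. verts (G i))" and "y \<in> (\<Pi>\<^sub>E i\<in>I. verts (G i))"
  shows "x = y \<or> x \<rightarrow>\<^bsub>with_proj (strong_product I G)\<^esub> y \<longleftrightarrow>
    (\<forall>i\<in>I. x i = y i \<or> x i \<rightarrow>\<^bsub>G i\<^esub> y i)"
  using assms by (auto simp: strong_product_def arcs_ends_def arc_to_ends_def)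

lemma finite_verts_graph:
  assumes "graph G"
  shows "finite (verts G)"
proof -
  interpret graph G by fact
  show ?thesis by (rule finite_verts)
qed

lemma finite_verts_strong_product:
  assumes "finite I" and "\<And>i. i \<in> I \<Longrightarrow> graph (G i)"
  shows "finite (verts (with_proj (strong_product I G)))"
  using assms by (auto intro!: finite_PiE finite_verts_graph)

lemma close_to_dominating_vertex:
  assumes "graph G" and "d \<in> dominating_vertices G" and "v \<in> verts G"
  shows "v = d \<or> v \<rightarrow>\<^bsub>G\<^esub> d"
proof -
  interpret graph G by fact
  show ?thesis
    using assms(2,3) by (auto simp: dominating_vertices_def intro: arcs_ends_symmetric[OF sym_arcs])
qed

lemma nondominating_vertex_exists:
  assumes "graph G" and "\<not> complete_digraph (card (verts G)) G"
  shows "verts G - dominating_vertices G \<noteq> {}"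
proof
  interpret graph G by fact
  assume "verts G - dominating_vertices G = {}"
  then have "u \<rightarrow>\<^bsub>G\<^esub> v" if "u \<in> verts G" "v \<in> verts G" "u \<noteq> v" for u v
    using that by (auto simp: dominating_vertices_def)
  then have "arcs_ends G = {(u, v). (u, v) \<in> verts G \<times> verts G \<and> u \<noteq> v}"
    by (auto dest: adj_in_verts adj_not_same)
  then show False
    using assms by (simp add: complete_digraph_def)
qed

lemma domination_number_product_le_factor:
  assumes "finite I" and "k \<in> I"
    and graph: "\<And>i. i \<in> I \<Longrightarrow> graph (G i)"
    and incomplete: "\<not> complete_digraph (card (verts (G k))) (G k)"
    and dominating: "\<And>i. i \<in> I \<Longrightarrow> dominating_vertices (G i) \<noteq> {}"
  shows "domination_number
      (remove_verts (with_proj (strong_product I G)) (\<Pi>\<^sub>E i\<in>I. dominating_vertices (G i)))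
    \<le> domination_number (remove_verts (G k) (dominating_vertices (G k)))"
    (is "domination_number ?H \<le> domination_number ?Gk")
proof -
  have fin: "finite (verts ?Gk)"
    using finite_verts_graph[OF graph] \<open>k \<in> I\<close> by simp
  then obtain Y where Y: "dominating_set ?Gk Y" "card Y = domination_number ?Gk"
    by (rule minimum_dominating_set_exists)
  have Y_sub: "Y \<subseteq> verts (G k) - dominating_vertices (G k)"
    and Y_cover: "\<And>v. v \<in> verts (G k) - dominating_vertices (G k) \<Longrightarrow>
      \<exists>y\<in>Y. v = y \<or> v \<rightarrow>\<^bsub>G k\<^esub> y"
    using Y(1) by (auto simp: dominating_set_remove_verts_iff)
  have "finite Y"
    using fin Y_sub by (auto intro: finite_subset)
  have "Y \<noteq> {}"
    using nondominating_vertex_exists[OF graph incomplete] \<open>k \<in> I\<close> Y_cover by blast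
  define d where "d i = (SOME v. v \<in> dominating_vertices (G i))" for i
  have d: "d i \<in> dominating_vertices (G i)" if "i \<in> I" for i
    using dominating[OF that] by (simp add: d_def some_in_eq)
  define lift where "lift y = (\<lambda>i\<in>I. if i = k then y else d i)" for y
  have lift_verts: "lift y \<in> (\<Pi>\<^sub>E i\<in>I. verts (G i))" if "y \<in> Y" for y
    using that d Y_sub by (auto simp: lift_def dominating_vertices_def)
  have lift_nondominating: "lift y \<notin> (\<Pi>\<^sub>E i\<in>I. dominating_vertices (G i))" if "y \<in> Y" for y
  proof
    assume "lift y \<in> (\<Pi>\<^sub>E i\<in>I. dominating_vertices (G i))"
    then have "lift y k \<in> dominating_vertices (G k)"
      using \<open>k \<in> I\<close> by (rule PiE_mem)
    then show False
      using that \<open>k \<in> I\<close> Y_sub by (auto simp: lift_def)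
  qed
  have "\<exists>x\<in>lift ` Y. v = x \<or> v \<rightarrow>\<^bsub>with_proj (strong_product I G)\<^esub> x"
    if v: "v \<in> (\<Pi>\<^sub>E i\<in>I. verts (G i))" for v
  proof -
    have v_verts: "v i \<in> verts (G i)" if "i \<in> I" for i
      using v that by (rule PiE_mem)
    have "\<exists>y\<in>Y. v k = y \<or> v k \<rightarrow>\<^bsub>G k\<^esub> y"
    proof (cases "v k \<in> dominating_vertices (G k)")
      case True
      then show ?thesis
        using \<open>Y \<noteq> {}\<close> Y_sub by (fastforce simp: dominating_vertices_def)
    next
      case False
      then show ?thesis
        using Y_cover v_verts[OF \<open>k \<in> I\<close>] by blast
    qed
    then obtain y where y: "y \<in> Y" "v k = y \<or> v k \<rightarrow>\<^bsub>G k\<^esub> y"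
      by blast
    have "\<forall>i\<in>I. v i = lift y i \<or> v i \<rightarrow>\<^bsub>G i\<^esub> lift y i"
      using y(2) close_to_dominating_vertex[OF graph d v_verts] by (simp add: lift_def)
    then have "v = lift y \<or> v \<rightarrow>\<^bsub>with_proj (strong_product I G)\<^esub> lift y"
      using strong_product_close_iff[OF v lift_verts[OF y(1)]] by blast
    then show ?thesis
      using y(1) by blast
  qed
  then have "dominating_set ?H (lift ` Y)"
    unfolding dominating_set_remove_verts_iff with_proj_simps(1) pverts_strong_product
    using lift_verts lift_nondominating by blast
  then have "domination_number ?H \<le> card (lift ` Y)"
    using finite_verts_strong_product[OF \<open>finite I\<close> graph] by (intro domination_number_le) auto
  also have "\<dots> \<le> card Y"
    using \<open>finite Y\<close> by (rule card_image_le)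
  finally show ?thesis
    using Y(2) by simp
qed

text \<open>
  The argument is the same for any sets \<open>S i\<close> in place of the sets of dominating vertices: all it
  uses is that a tuple outside their product has a coordinate \<open>i\<close> outside \<open>S i\<close>.
\<close>

lemma some_factor_domination_number_le_product:
  assumes "finite I"
    and graph: "\<And>i. i \<in> I \<Longrightarrow> graph (G i)"
    and "I \<noteq> {}"
  shows "\<exists>i\<in>I. domination_number (remove_verts (G i) (S i)) \<le>
    domination_number (remove_verts (with_proj (strong_product I G)) (\<Pi>\<^sub>E i\<in>I. S i))"
    (is "\<exists>i\<in>I. _ \<le> domination_number ?H")
proof -
  have fin: "finite (verts ?H)"
    using finite_verts_strong_product[OF \<open>finite I\<close> graph] by simp
  then obtain X where X: "dominating_set ?H X" "card X = domination_number ?H"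
    by (rule minimum_dominating_set_exists)
  have X_sub: "X \<subseteq> (\<Pi>\<^sub>E i\<in>I. verts (G i)) - (\<Pi>\<^sub>E i\<in>I. S i)"
    and X_cover: "\<And>v. v \<in> (\<Pi>\<^sub>E i\<in>I. verts (G i)) - (\<Pi>\<^sub>E i\<in>I. S i) \<Longrightarrow>
      \<exists>x\<in>X. v = x \<or> v \<rightarrow>\<^bsub>with_proj (strong_product I G)\<^esub> x"
    using X(1) unfolding dominating_set_remove_verts_iff with_proj_simps(1) pverts_strong_product by blast+
  have "finite X"
    using fin X_sub by (auto intro: finite_subset)
  define shadow where "shadow i = (\<lambda>x. x i) ` X - S i" for i
  have shadow_sub: "shadow i \<subseteq> verts (G i) - S i" if "i \<in> I" for i
    using X_sub that by (auto simp: shadow_def)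
  have "\<exists>i\<in>I. dominating_set (remove_verts (G i) (S i)) (shadow i)"
  proof (rule ccontr)
    assume "\<not> ?thesis"
    then have "\<forall>i\<in>I. \<exists>w. w \<in> verts (G i) - S i \<and> (\<forall>x\<in>shadow i. \<not> (w = x \<or> w \<rightarrow>\<^bsub>G i\<^esub> x))"
      using shadow_sub unfolding dominating_set_remove_verts_iff by blast
    then obtain w where w: "\<And>i. i \<in> I \<Longrightarrow> w i \<in> verts (G i) - S i"
      and far: "\<And>i x. i \<in> I \<Longrightarrow> x \<in> shadow i \<Longrightarrow> \<not> (w i = x \<or> w i \<rightarrow>\<^bsub>G i\<^esub> x)"
      by metis
    define v where "v = restrict w I"
    have v: "v \<in> (\<Pi>\<^sub>E i\<in>I. verts (G i))"
      using w by (auto simp: v_def)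
    have "v \<notin> (\<Pi>\<^sub>E i\<in>I. S i)"
      using w \<open>I \<noteq> {}\<close> by (auto simp: v_def PiE_iff)
    then obtain x where x: "x \<in> X" "v = x \<or> v \<rightarrow>\<^bsub>with_proj (strong_product I G)\<^esub> x"
      using X_cover v by blast
    have x_verts: "x \<in> (\<Pi>\<^sub>E i\<in>I. verts (G i))" and "x \<notin> (\<Pi>\<^sub>E i\<in>I. S i)"
      using X_sub x(1) by blast+
    then obtain i where i: "i \<in> I" "x i \<notin> S i"
      by (auto simp: PiE_iff)
    have "v i = x i \<or> v i \<rightarrow>\<^bsub>G i\<^esub> x i"
      using strong_product_close_iff[OF v x_verts] x(2) i(1) by blast
    moreover have "x i \<in> shadow i"
      using x(1) i(2) by (auto simp: shadow_def)
    ultimately show False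
      using far[OF i(1)] i(1) by (simp add: v_def)
  qed
  then obtain i where i: "i \<in> I" "dominating_set (remove_verts (G i) (S i)) (shadow i)"
    by blast
  have "domination_number (remove_verts (G i) (S i)) \<le> card (shadow i)"
    using i finite_verts_graph[OF graph] by (intro domination_number_le) auto
  also have "\<dots> \<le> card ((\<lambda>x. x i) ` X)"
    using \<open>finite X\<close> by (auto simp: shadow_def intro: card_mono)
  also have "\<dots> \<le> card X"
    using \<open>finite X\<close> by (rule card_image_le)
  finally show ?thesis
    using i(1) X(2) by auto
qed

theorem theorem1p4:
  fixes \<Gamma> :: "nat \<Rightarrow> ('a, 'b) pre_digraph" and t :: nat
  assumes "t \<ge> 1"
    and "\<And>i. i \<in> {1..t} \<Longrightarrow> graph (\<Gamma> i)"
    and "\<And>i. i \<in> {1..t} \<Longrightarrow> \<not> complete_digraph (card (verts (\<Gamma> i))) (\<Gamma> i)"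
    and "\<And>i. i \<in> {1..t} \<Longrightarrow> dominating_vertices (\<Gamma> i) \<noteq> {}"
  shows "domination_number
           (remove_verts (with_proj (strong_product {1..t} \<Gamma>))
              (\<Pi>\<^sub>E i\<in>{1..t}. dominating_vertices (\<Gamma> i)))
         = (MIN i\<in>{1..t}. domination_number (remove_verts (\<Gamma> i) (dominating_vertices (\<Gamma> i))))"
    (is "?\<gamma> = Min (?f ` _)")
proof (rule antisym)
  have "?\<gamma> \<le> ?f i" if "i \<in> {1..t}" for i
    using that assms by (intro domination_number_product_le_factor) auto
  then show "?\<gamma> \<le> Min (?f ` {1..t})"
    using assms(1) by (intro Min.boundedI) auto
next
  have "\<exists>i\<in>{1..t}. ?f i \<le> ?\<gamma>"
    using assms(1,2) by (intro some_factor_domination_number_le_product) auto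
  then show "Min (?f ` {1..t}) \<le> ?\<gamma>"
    by (auto intro: Min_le order_trans)
qed

end
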